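(* Let $n \in \mathbb{N}$ and let $p$ be a real number with $\frac{\ln(4/3)}{n} \le p < 1$. Let $X$ be a binomially distributed random variable with parameters $n$ and $p$. If $(n,p) \ne (2,\frac{1}{2})$, then $\Pr[X > E[X]] > \frac{1}{4}$; if $(n,p) = (2,\frac{1}{2})$, then $\Pr[X > E[X]] = \frac{1}{4}$.
   Context: $\mathbb{N} = \{1, 2, \dots\}$. A random variable $X$ is binomially distributed with parameters $n$ and $p$ if $\Pr[X=i] = \binom{n}{i} p^i (1-p)^{n-i}$ for all $i \in \{0,1,\dots,n\}$; then $E[X] = np$. *)

theory Defs
  imports "HOL-Probability.Probability"
begin

text \<open>
  The point masses at \<open>0, \<dots>, n\<close> add up to 1, so on a probability space they determine the
  distribution of \<open>X\<close>; no separate condition on the range of \<open>X\<close> is needed.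
\<close>

definition binomially_distributed :: "'a measure \<Rightarrow> ('a \<Rightarrow> real) \<Rightarrow> nat \<Rightarrow> real \<Rightarrow> bool" where
  "binomially_distributed M X n p \<longleftrightarrow>
     X \<in> borel_measurable M \<and>
     (\<forall>i\<in>{0..n}. measure M {\<omega> \<in> space M. X \<omega> = real i} =
        real (n choose i) * p ^ i * (1 - p) ^ (n - i))"

end

theory Submission
  imports Defs
begin

text \<open>
  Let \<open>k\<close> be the integer part of \<open>n p\<close>; the claim concerns \<open>Pr[X \<ge> k + 1]\<close>.  If \<open>k = 0\<close>, this is
  \<open>1 - (1 - p)\<^sup>n > 1 - exp (- n p) \<ge> 1/4\<close>, which is where the lower bound on \<open>p\<close> comes from.
  If \<open>k \<ge> 1\<close>, the tail grows with \<open>p\<close> (\<open>bin_tail_mono\<close>), so it suffices to take \<open>p = k / n\<close>, where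
  the mean is the integer \<open>k\<close>.

  Put \<open>m = n - k\<close> and divide all weights by the weight of \<open>k\<close>.  The weights of \<open>k + j\<close> become
  explicit products \<open>rel_mass k m j\<close>, and by exchanging success and failure the weights of \<open>k - j\<close>
  become \<open>rel_mass m k j\<close>.  With their sums \<open>R\<close> above and \<open>L\<close> below the mean, the total mass is
  proportional to \<open>L + 1 + R\<close>, and the claim becomes \<open>1 + L < 3 R\<close>.

  The two sides of the mean are compared term by term; the quotient of \<open>rel_mass k m j\<close> and
  \<open>rel_mass m k j\<close> has a single turning point in \<open>j\<close>.  For \<open>k > m\<close> it starts at 1, rises and then
  falls, so it crosses 1 only once; since the mean is \<open>k\<close>, both sides have the same first moment,
  and \<open>R \<ge> L\<close> follows (\<open>rel_tail_ge_swap\<close>).  For \<open>k < m\<close> it falls first, but for \<open>k \<ge> 3\<close> it never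
  falls below \<open>2/3\<close> (\<open>rel_mass_ge_swap\<close>).  Together with the first few terms of the sums, which
  also settle \<open>k = 1\<close> and \<open>k = 2\<close>, this gives the inequality in all cases except \<open>k = m = 1\<close>
  (\<open>rel_tail_key\<close>).  In that case equality holds at \<open>p = 1/2\<close>, and for \<open>n = 2\<close> and \<open>p > 1/2\<close> the
  tail \<open>p\<^sup>2\<close> is strictly larger.
\<close>

section \<open>Binomial weights and tails\<close>

definition bin_mass :: "nat \<Rightarrow> real \<Rightarrow> nat \<Rightarrow> real" where
  "bin_mass n p i = real (n choose i) * p ^ i * (1 - p) ^ (n - i)"

definition bin_tail :: "nat \<Rightarrow> real \<Rightarrow> nat \<Rightarrow> real" where
  "bin_tail n p j = (\<Sum>i=j..n. bin_mass n p i)"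

lemma bin_mass_nonneg: "0 \<le> p \<Longrightarrow> p \<le> 1 \<Longrightarrow> 0 \<le> bin_mass n p i"
  by (simp add: bin_mass_def)

lemma sum_bin_mass: "(\<Sum>i=0..n. bin_mass n p i) = 1"
proof -
  have "(p + (1 - p)) ^ n = (\<Sum>i\<le>n. real (n choose i) * p ^ i * (1 - p) ^ (n - i))"
    by (rule binomial_ring)
  then show ?thesis by (simp add: bin_mass_def atLeast0AtMost)
qed

lemma bin_mass_Suc_Suc:
  "bin_mass (Suc n) p (Suc i) = p * bin_mass n p i + (1 - p) * bin_mass n p (Suc i)"
proof (cases "i < n")
  case True
  then have "n - i = Suc (n - Suc i)" by simp
  then show ?thesis by (simp add: bin_mass_def algebra_simps)
next
  case False
  then show ?thesis by (cases "i = n") (auto simp: bin_mass_def binomial_eq_0)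
qed

lemma bin_mass_ratio:
  assumes "i < n"
  shows "bin_mass n p (Suc i) * (real (Suc i) * (1 - p)) = bin_mass n p i * (real (n - i) * p)"
proof -
  have *: "n - i = Suc (n - Suc i)" using assms by simp
  have "Suc i * (n choose Suc i) = (n - i) * (n choose i)"
    by (simp only: binomial_absorb_comp binomial_absorption)
  then have **: "real (Suc i) * real (n choose Suc i) = real (n - i) * real (n choose i)"
    by (metis of_nat_mult)
  have "bin_mass n p (Suc i) * (real (Suc i) * (1 - p))
      = (real (Suc i) * real (n choose Suc i)) * p ^ Suc i * ((1 - p) ^ (n - Suc i) * (1 - p))"
    by (simp add: bin_mass_def)
  also have "\<dots> = (real (n - i) * real (n choose i)) * p ^ Suc i * (1 - p) ^ (n - i)"
    unfolding ** by (simp add: *)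
  finally show ?thesis by (simp only: bin_mass_def power_Suc ac_simps)
qed

lemma bin_mass_reflect:
  assumes "i \<le> n"
  shows "bin_mass n p (n - i) = bin_mass n (1 - p) i"
  using assms by (simp add: bin_mass_def binomial_symmetric[symmetric])

lemma bin_tail_0: "bin_tail n p 0 = 1"
  by (simp add: bin_tail_def sum_bin_mass)

lemma bin_tail_Suc_le:
  assumes "0 \<le> p" "p \<le> 1"
  shows "bin_tail n p (Suc j) \<le> bin_tail n p j"
  unfolding bin_tail_def
  by (rule sum_mono2) (auto simp: bin_mass_nonneg assms)

text \<open>Conditioning on the last of the \<open>n + 1\<close> trials.\<close>

lemma bin_tail_Suc_Suc:
  "bin_tail (Suc n) p (Suc j) = p * bin_tail n p j + (1 - p) * bin_tail n p (Suc j)"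
proof -
  have "bin_tail (Suc n) p (Suc j) = (\<Sum>i=j..n. bin_mass (Suc n) p (Suc i))"
    unfolding bin_tail_def by (rule sum.shift_bounds_cl_Suc_ivl)
  also have "\<dots> = p * bin_tail n p j + (1 - p) * (\<Sum>i=j..n. bin_mass n p (Suc i))"
    by (simp add: bin_mass_Suc_Suc sum.distrib sum_distrib_left bin_tail_def)
  also have "(\<Sum>i=j..n. bin_mass n p (Suc i)) = (\<Sum>i=Suc j..Suc n. bin_mass n p i)"
    by (rule sum.shift_bounds_cl_Suc_ivl[symmetric])
  also have "\<dots> = bin_tail n p (Suc j)"
    unfolding bin_tail_def
    by (rule sum.mono_neutral_right) (auto simp: bin_mass_def)
  finally show ?thesis .
qed

lemma bin_tail_mono:
  assumes "0 \<le> p" "p \<le> q" "q \<le> 1"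
  shows "bin_tail n p j \<le> bin_tail n q j"
proof (induction n arbitrary: j)
  case 0
  show ?case by (simp add: bin_tail_def bin_mass_def)
next
  case (Suc n)
  show ?case
  proof (cases j)
    case 0
    then show ?thesis by (simp add: bin_tail_0)
  next
    case (Suc i)
    have "p * bin_tail n p i + (1 - p) * bin_tail n p (Suc i)
        \<le> p * bin_tail n q i + (1 - p) * bin_tail n q (Suc i)"
      using assms Suc.IH by (intro add_mono mult_left_mono) auto
    also have "\<dots> = bin_tail n q (Suc i) + p * (bin_tail n q i - bin_tail n q (Suc i))"
      by (simp add: algebra_simps)
    also have "\<dots> \<le> bin_tail n q (Suc i) + q * (bin_tail n q i - bin_tail n q (Suc i))"
      using assms bin_tail_Suc_le[of q n i] by (intro add_mono mult_right_mono) auto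
    also have "\<dots> = q * bin_tail n q i + (1 - q) * bin_tail n q (Suc i)"
      by (simp add: algebra_simps)
    finally show ?thesis unfolding Suc bin_tail_Suc_Suc .
  qed
qed

section \<open>Weights relative to an integral mean\<close>

definition step_ratio :: "nat \<Rightarrow> nat \<Rightarrow> nat \<Rightarrow> real" where
  "step_ratio k m i = (1 - real i / real m) / (1 + real (Suc i) / real k)"

text \<open>
  With \<open>k\<close> expected successes and \<open>m\<close> expected failures in \<open>k + m\<close> trials, this is the weight of
  \<open>k + j\<close> divided by the weight of \<open>k\<close>; exchanging success and failure, \<open>rel_mass m k j\<close> is the
  weight of \<open>k - j\<close> divided by the weight of \<open>k\<close>.  The last factor \<open>i = m\<close> vanishes, so no bound
  on \<open>j\<close> is needed.
\<close>

definition rel_mass :: "nat \<Rightarrow> nat \<Rightarrow> nat \<Rightarrow> real" where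
  "rel_mass k m j = (\<Prod>i<j. step_ratio k m i)"

definition rel_tail :: "nat \<Rightarrow> nat \<Rightarrow> real" where
  "rel_tail k m = (\<Sum>j=1..m. rel_mass k m j)"

lemma rel_mass_0 [simp]: "rel_mass k m 0 = 1"
  by (simp add: rel_mass_def)

lemma rel_mass_Suc: "rel_mass k m (Suc j) = rel_mass k m j * step_ratio k m j"
  by (simp add: rel_mass_def)

lemma step_ratio_nonneg: "i \<le> m \<Longrightarrow> 0 \<le> step_ratio k m i"
  by (cases "m = 0") (auto simp: step_ratio_def divide_simps)

lemma rel_mass_eq_0:
  assumes "m \<ge> 1" "m < j"
  shows "rel_mass k m j = 0"
  unfolding rel_mass_def
  by (rule prod_zero) (use assms in \<open>auto simp: step_ratio_def intro!: bexI[of _ m]\<close>)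

lemma rel_mass_nonneg:
  assumes "m \<ge> 1"
  shows "0 \<le> rel_mass k m j"
proof (cases "m < j")
  case True
  then show ?thesis using assms by (simp add: rel_mass_eq_0)
next
  case False
  then show ?thesis unfolding rel_mass_def
    by (intro prod_nonneg) (auto intro!: step_ratio_nonneg)
qed

lemma rel_tail_extend:
  assumes "m \<ge> 1" "m \<le> N"
  shows "rel_tail k m = (\<Sum>j=1..N. rel_mass k m j)"
  unfolding rel_tail_def
  by (rule sum.mono_neutral_left) (use assms in \<open>auto intro!: rel_mass_eq_0\<close>)

lemma bin_mass_above_mean:
  assumes "k \<ge> 1" "m \<ge> 1" "j \<le> m"
  defines "q \<equiv> real k / real (k + m)"
  shows "bin_mass (k + m) q (k + j) = bin_mass (k + m) q k * rel_mass k m j"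
  using \<open>j \<le> m\<close>
proof (induction j)
  case 0
  then show ?case by simp
next
  case (Suc j)
  let ?n = "real (k + m)"
  have n: "?n > 0" using assms by simp
  have q1: "1 - q = real m / ?n" using n by (simp add: q_def divide_simps)
  have "bin_mass (k + m) q (Suc (k + j)) * (real (Suc (k + j)) * (real m / ?n))
      = bin_mass (k + m) q (k + j) * (real (k + m - (k + j)) * (real k / ?n))"
    using bin_mass_ratio[of "k + j" "k + m" q] Suc.prems unfolding q1 by (simp add: q_def)
  then have "bin_mass (k + m) q (Suc (k + j)) * (real (Suc (k + j)) * real m)
      = bin_mass (k + m) q (k + j) * ((real m - real j) * real k)"
    using n Suc.prems by (simp add: field_simps of_nat_diff)
  then have "bin_mass (k + m) q (Suc (k + j))
      = bin_mass (k + m) q (k + j) * ((real m - real j) * real k) / (real (Suc (k + j)) * real m)"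
    using assms by (subst eq_divide_eq) auto
  also have "\<dots> = bin_mass (k + m) q (k + j) * step_ratio k m j"
    using assms by (simp add: step_ratio_def divide_simps)
  finally show ?case using Suc by (simp add: rel_mass_Suc)
qed

lemma bin_mass_below_mean:
  assumes "k \<ge> 1" "m \<ge> 1" "j \<le> k"
  defines "q \<equiv> real k / real (k + m)"
  shows "bin_mass (k + m) q (k - j) = bin_mass (k + m) q k * rel_mass m k j"
proof -
  have q1: "1 - q = real m / real (m + k)" using assms by (simp add: q_def divide_simps)
  have "bin_mass (k + m) q (k - j) = bin_mass (k + m) (1 - q) (m + j)"
    using bin_mass_reflect[of "m + j" "k + m" q] assms by simp
  also have "\<dots> = bin_mass (k + m) (1 - q) m * rel_mass m k j"
    using bin_mass_above_mean[of m k j] assms unfolding q1 by (simp add: add.commute)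
  also have "bin_mass (k + m) (1 - q) m = bin_mass (k + m) q k"
    using bin_mass_reflect[of m "k + m" q] by simp
  finally show ?thesis .
qed

text \<open>
  All weights are multiples of the weight of the mean, so the tail bound no longer involves
  binomial coefficients.
\<close>

lemma bin_tail_gt_quarter_iff:
  assumes "k \<ge> 1" "m \<ge> 1"
  shows "bin_tail (k + m) (real k / real (k + m)) (Suc k) > 1 / 4
    \<longleftrightarrow> 1 + rel_tail m k < 3 * rel_tail k m"
proof -
  define q where "q = real k / real (k + m)"
  define a where "a = bin_mass (k + m) q k"
  have "0 < q" "q < 1" using assms by (simp_all add: q_def)
  then have a: "a > 0" by (simp add: a_def bin_mass_def)
  have up: "bin_tail (k + m) q (Suc k) = a * rel_tail k m"
  proof -
    have "bin_tail (k + m) q (Suc k) = (\<Sum>j=1..m. bin_mass (k + m) q (k + j))"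
      unfolding bin_tail_def
      by (rule sum.reindex_bij_witness[of _ "\<lambda>j. k + j" "\<lambda>i. i - k"]) auto
    also have "\<dots> = (\<Sum>j=1..m. a * rel_mass k m j)"
      unfolding a_def q_def by (intro sum.cong) (use assms bin_mass_above_mean in auto)
    finally show ?thesis by (simp add: rel_tail_def sum_distrib_left)
  qed
  have low: "(\<Sum>i<k. bin_mass (k + m) q i) = a * rel_tail m k"
  proof -
    have "(\<Sum>i<k. bin_mass (k + m) q i) = (\<Sum>j=1..k. bin_mass (k + m) q (k - j))"
      by (rule sum.reindex_bij_witness[of _ "\<lambda>j. k - j" "\<lambda>i. k - i"]) auto
    also have "\<dots> = (\<Sum>j=1..k. a * rel_mass m k j)"
      unfolding a_def q_def by (intro sum.cong) (use assms bin_mass_below_mean in auto)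
    finally show ?thesis by (simp add: rel_tail_def sum_distrib_left)
  qed
  have "{0..k + m} = insert k {..<k} \<union> {Suc k..k + m}" by auto
  then have "(\<Sum>i=0..k + m. bin_mass (k + m) q i)
      = (\<Sum>i\<in>insert k {..<k} \<union> {Suc k..k + m}. bin_mass (k + m) q i)" by (rule arg_cong)
  also have "\<dots> = a + (\<Sum>i<k. bin_mass (k + m) q i) + bin_tail (k + m) q (Suc k)"
    unfolding bin_tail_def by (subst sum.union_disjoint) (auto simp: a_def)
  finally have "1 = a * (1 + rel_tail m k + rel_tail k m)"
    unfolding sum_bin_mass up low by (simp add: algebra_simps)
  then have "4 * (a * rel_tail k m) - 1 = a * (3 * rel_tail k m - (1 + rel_tail m k))"
    by (simp add: algebra_simps)
  then have "a * rel_tail k m > 1 / 4 \<longleftrightarrow> a * (3 * rel_tail k m - (1 + rel_tail m k)) > 0"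
    by linarith
  then show ?thesis using a up unfolding q_def[symmetric] by (simp add: zero_less_mult_iff)
qed

section \<open>Comparing both sides of the mean\<close>

text \<open>
  After clearing the positive denominators, the second factor on the right carries all dependence
  on \<open>i\<close>, and it changes its sign only once, from positive to negative.  Hence the quotient of
  \<open>rel_mass k m j\<close> and \<open>rel_mass m k j\<close> is monotone in \<open>j\<close> on either side of one turning point.
\<close>

lemma step_ratio_diff_swap:
  assumes "k \<ge> 1" "m \<ge> 1"
  defines "x \<equiv> 1 / real m" and "y \<equiv> 1 / real k"
  shows "(step_ratio k m i - step_ratio m k i) * ((1 + real (Suc i) * y) * (1 + real (Suc i) * x))
    = (x - y) * (1 - real i * real (Suc i) * (x + y))"
proof -
  have p: "1 + real (Suc i) * y > 0" "1 + real (Suc i) * x > 0"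
    using assms by (auto intro!: add_pos_nonneg)
  have s: "step_ratio k m i = (1 - real i * x) / (1 + real (Suc i) * y)"
    "step_ratio m k i = (1 - real i * y) / (1 + real (Suc i) * x)"
    by (simp_all add: step_ratio_def x_def y_def)
  have "(step_ratio k m i - step_ratio m k i) * ((1 + real (Suc i) * y) * (1 + real (Suc i) * x))
    = (1 - real i * x) * (1 + real (Suc i) * x) - (1 - real i * y) * (1 + real (Suc i) * y)"
    unfolding s using p by (simp add: divide_simps)
  also have "\<dots> = (x - y) * (1 - real i * real (Suc i) * (x + y))"
    by (simp add: algebra_simps)
  finally show ?thesis .
qed

lemma step_ratio_le:
  assumes "1 \<le> m" "m \<le> k"
  shows "real i * real (Suc i) * (1 / real m + 1 / real k) \<ge> 1 \<Longrightarrow>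
      step_ratio k m i \<le> step_ratio m k i"
    and "real i * real (Suc i) * (1 / real m + 1 / real k) \<le> 1 \<Longrightarrow>
      step_ratio m k i \<le> step_ratio k m i"
proof -
  let ?x = "1 / real m" and ?y = "1 / real k"
  let ?P = "(1 + real (Suc i) * ?y) * (1 + real (Suc i) * ?x)"
  have P: "?P > 0" using assms by (intro mult_pos_pos add_pos_nonneg) auto
  have xy: "?x - ?y \<ge> 0" using assms by (simp add: frac_le)
  have eq: "(step_ratio k m i - step_ratio m k i) * ?P
      = (?x - ?y) * (1 - real i * real (Suc i) * (?x + ?y))"
    using assms by (intro step_ratio_diff_swap) auto
  show "step_ratio k m i \<le> step_ratio m k i"
    if "real i * real (Suc i) * (?x + ?y) \<ge> 1"
  proof -
    have "(step_ratio k m i - step_ratio m k i) * ?P \<le> 0 * ?P"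
      unfolding eq mult_zero_left using xy that by (intro mult_nonneg_nonpos) auto
    then have "step_ratio k m i - step_ratio m k i \<le> 0"
      by (rule mult_right_le_imp_le[OF _ P])
    then show ?thesis by simp
  qed
  show "step_ratio m k i \<le> step_ratio k m i"
    if "real i * real (Suc i) * (?x + ?y) \<le> 1"
  proof -
    have "0 * ?P \<le> (step_ratio k m i - step_ratio m k i) * ?P"
      unfolding eq mult_zero_left using xy that by (intro mult_nonneg_nonneg) auto
    then have "0 \<le> step_ratio k m i - step_ratio m k i"
      by (rule mult_right_le_imp_le[OF _ P])
    then show ?thesis by simp
  qed
qed

text \<open>
  The first moment is symmetric in \<open>k\<close> and \<open>m\<close>: this expresses that the positive and the negative
  part of the deviation from the mean have equal expectations.  The recursion for \<open>rel_mass\<close> turns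
  the sum into a telescoping one.
\<close>

lemma rel_mass_first_moment:
  assumes "k \<ge> 1" "m \<ge> 1" "m < N"
  shows "(\<Sum>j\<le>N. real j * rel_mass k m j) * (1 / real m + 1 / real k) = 1"
proof -
  have step: "rel_mass k m (Suc j) - rel_mass k m j =
    - (real j * rel_mass k m j / real m + real (Suc j) * rel_mass k m (Suc j) / real k)" for j
  proof -
    have p: "1 + real (Suc j) / real k > 0" using assms by (intro add_pos_nonneg) auto
    have "rel_mass k m (Suc j) * (1 + real (Suc j) / real k) = rel_mass k m j * (1 - real j / real m)"
      unfolding rel_mass_Suc step_ratio_def using p by simp
    then show ?thesis by (simp add: algebra_simps)
  qed
  have tel: "rel_mass k m M - 1 = - ((\<Sum>j<M. real j * rel_mass k m j) / real m
      + (\<Sum>j\<le>M. real j * rel_mass k m j) / real k)" for M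
  proof (induction M)
    case 0
    then show ?case by simp
  next
    case (Suc M)
    then show ?case using step[of M] by (simp add: add_divide_distrib)
  qed
  have z: "rel_mass k m N = 0" using assms by (intro rel_mass_eq_0) auto
  have "(\<Sum>j\<le>N. real j * rel_mass k m j) = (\<Sum>j<N. real j * rel_mass k m j)"
    using z by (simp add: lessThan_Suc_atMost[symmetric])
  then show ?thesis using tel[of N] z by (simp add: algebra_simps)
qed

text \<open>
  If the mean is at least half the number of trials, then up to some distance \<open>J\<close> the weights above
  the mean are at least those at the same distance below it, and from there on at most those.
  The first moments agree, so the surplus near the mean has the same moment as the deficit far
  from it, and having shorter distances it must have the larger mass.
\<close>

lemma rel_tail_ge_swap:
  assumes m: "1 \<le> m" and mk: "m \<le> k"
  shows "rel_tail m k \<le> rel_tail k m"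
proof -
  define N where "N = Suc (k + m)"
  define D where "D j = rel_mass k m j - rel_mass m k j" for j
  have k: "1 \<le> k" using m mk by simp
  have tails: "rel_tail k m - rel_tail m k = (\<Sum>j=1..N. D j)"
    using rel_tail_extend[of m N k] rel_tail_extend[of k N m] m k
    by (simp add: D_def N_def sum_subtractf)
  have moment: "(\<Sum>j=1..N. real j * D j) = 0"
  proof -
    have c: "1 / real m + 1 / real k > 0" using m k by (intro add_pos_pos) auto
    have "(\<Sum>j\<le>N. real j * rel_mass k m j) * (1 / real m + 1 / real k)
        = (\<Sum>j\<le>N. real j * rel_mass m k j) * (1 / real m + 1 / real k)"
      using rel_mass_first_moment[of k m N] rel_mass_first_moment[of m k N] m k
      by (simp add: N_def add.commute)
    then have "(\<Sum>j\<le>N. real j * D j) = 0"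
      using c by (simp add: D_def right_diff_distrib sum_subtractf)
    moreover have "(\<Sum>j\<le>N. real j * D j) = (\<Sum>j=1..N. real j * D j)"
      by (rule sum.mono_neutral_right) auto
    ultimately show ?thesis by simp
  qed
  show ?thesis
  proof (cases "\<forall>j. D j \<ge> 0")
    case True
    then have "(\<Sum>j=1..N. D j) \<ge> 0" by (intro sum_nonneg) auto
    then show ?thesis using tails by simp
  next
    case False
    define J where "J = (LEAST j. D j < 0)"
    have J: "D J < 0" unfolding J_def
      using LeastI_ex[of "\<lambda>j. D j < 0"] False by (auto simp: not_le)
    have before: "D j \<ge> 0" if "j < J" for j
      using not_less_Least[of j "\<lambda>j. D j < 0"] that unfolding J_def by auto
    have "J \<noteq> 0"
    proof
      assume "J = 0"
      with J show False by (simp add: D_def)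
    qed
    then obtain I where I: "J = Suc I" using not0_implies_Suc by blast
    define c where "c j = real j * real (Suc j) * (1 / real m + 1 / real k)" for j
    have large: "c I \<ge> 1"
    proof (rule ccontr)
      assume small: "\<not> c I \<ge> 1"
      then have st: "step_ratio m k I \<le> step_ratio k m I"
        using step_ratio_le(2)[OF m mk, of I] unfolding c_def by linarith
      have Im: "I \<le> m"
      proof (rule ccontr)
        assume "\<not> I \<le> m"
        then have "real m * 1 * (1 / real m) \<le> real I * real (Suc I) * (1 / real m)"
          using m by (intro mult_mono) auto
        moreover have "real m * 1 * (1 / real m) = 1" using m by simp
        moreover have "real I * real (Suc I) * (1 / real k) \<ge> 0" by simp
        ultimately show False using small unfolding c_def distrib_left by linarith
      qed
      have "rel_mass m k I * step_ratio m k I \<le> rel_mass k m I * step_ratio k m I"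
        using before[of I] I st Im mk k m
        by (intro mult_mono) (auto simp: D_def intro!: step_ratio_nonneg rel_mass_nonneg)
      then show False using J I by (simp add: D_def rel_mass_Suc)
    qed
    have after: "D (J + d) \<le> 0" for d
    proof (induction d)
      case 0
      then show ?case using J by simp
    next
      case (Suc d)
      show ?case
      proof (cases "J + d \<le> m")
        case True
        have "c I \<le> c (J + d)"
          unfolding c_def using I by (intro mult_right_mono mult_mono) auto
        then have "step_ratio k m (J + d) \<le> step_ratio m k (J + d)"
          using step_ratio_le(1)[OF m mk, of "J + d"] large unfolding c_def by linarith
        then have "rel_mass k m (J + d) * step_ratio k m (J + d)
            \<le> rel_mass m k (J + d) * step_ratio m k (J + d)"
          using Suc.IH True mk k m
          by (intro mult_mono) (auto simp: D_def intro!: step_ratio_nonneg rel_mass_nonneg)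
        then show ?thesis by (simp add: D_def rel_mass_Suc)
      next
        case False
        then show ?thesis using m k by (simp add: D_def rel_mass_eq_0 rel_mass_nonneg)
      qed
    qed
    have "0 \<le> (\<Sum>j=1..N. (real J - real j) * D j)"
    proof (rule sum_nonneg)
      fix j
      show "0 \<le> (real J - real j) * D j"
      proof (cases "j < J")
        case True
        then show ?thesis using before by simp
      next
        case False
        then show ?thesis using after[of "j - J"] by (intro mult_nonpos_nonpos) auto
      qed
    qed
    also have "\<dots> = real J * (\<Sum>j=1..N. D j) - (\<Sum>j=1..N. real j * D j)"
      by (simp add: left_diff_distrib sum_subtractf sum_distrib_left)
    finally have "0 \<le> real J * (\<Sum>j=1..N. D j)" using moment by simp
    then show ?thesis using tails \<open>J \<noteq> 0\<close> by (simp add: zero_le_mult_iff)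
  qed
qed

text \<open>
  The product is the limit of \<open>rel_mass m k s / rel_mass k m s\<close> for \<open>m \<rightarrow> \<infinity>\<close>.  For \<open>k \<ge> 5\<close> it is at
  most \<open>exp (1/3)\<close>: the deviations of the factors from 1 add up to at most \<open>1/3\<close>, because
  \<open>k\<^sup>2 - 3 k s + s\<^sup>3 - s\<close> is a quadratic in \<open>k\<close> with negative discriminant for \<open>s \<ge> 3\<close>, and
  its roots are smaller than 5 for \<open>s \<le> 2\<close>.  For \<open>k = 3\<close> and \<open>k = 4\<close> that sum can exceed
  \<open>1/3\<close>, and the few products are computed instead.
\<close>

lemma correction_prod_le:
  assumes k: "3 \<le> k" and s: "s \<le> k"
  shows "(\<Prod>i<s. 1 + 1 / real k - real i * real (Suc i) / (real k)\<^sup>2) \<le> 3 / 2"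
proof (cases "5 \<le> k")
  case True
  have sum: "(\<Sum>i<s. 1 / real k - real i * real (Suc i) / (real k)\<^sup>2)
      = (3 * real k * real s - (real s ^ 3 - real s)) / (3 * (real k)\<^sup>2)"
  proof (induction s)
    case 0
    show ?case by simp
  next
    case (Suc s)
    show ?case unfolding sum.lessThan_Suc Suc.IH
      using k by (simp add: divide_simps) (simp add: power2_eq_square power3_eq_cube algebra_simps)
  qed
  have poly: "3 * real k * real s - (real s ^ 3 - real s) \<le> (real k)\<^sup>2"
  proof -
    consider "s = 0" | "s = 1" | "s = 2" | "3 \<le> s" by linarith
    then show ?thesis
    proof cases
      case 4
      have "0 \<le> (4 * real s + 3) * (real s - 3) + 5" using 4 by simp
      then have "0 \<le> real s * ((4 * real s + 3) * (real s - 3) + 5)" by simp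
      moreover have "0 \<le> (2 * real k - 3 * real s)\<^sup>2" by simp
      ultimately show ?thesis by (simp add: power2_eq_square power3_eq_cube algebra_simps)
    next
      case 2
      have "0 \<le> real k * (real k - 3)" using True by simp
      then show ?thesis using 2 by (simp add: power2_eq_square algebra_simps)
    next
      case 3
      have "0 \<le> (real k - 1) * (real k - 5)" using True by simp
      then show ?thesis using 3 True by (simp add: power2_eq_square algebra_simps)
    qed auto
  qed
  have "(\<Prod>i<s. 1 + 1 / real k - real i * real (Suc i) / (real k)\<^sup>2)
      \<le> (\<Prod>i<s. exp (1 / real k - real i * real (Suc i) / (real k)\<^sup>2))"
  proof (intro prod_mono conjI)
    fix i assume "i \<in> {..<s}"
    then have "Suc i \<le> k" using s by simp
    then have "real i * real (Suc i) \<le> real k * real k" by (intro mult_mono) auto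
    then have "real i * real (Suc i) / (real k)\<^sup>2 \<le> 1"
      using k by (simp add: power2_eq_square divide_le_eq)
    moreover have "0 \<le> 1 / real k" by simp
    ultimately show "0 \<le> 1 + 1 / real k - real i * real (Suc i) / (real k)\<^sup>2" by linarith
    show "1 + 1 / real k - real i * real (Suc i) / (real k)\<^sup>2
        \<le> exp (1 / real k - real i * real (Suc i) / (real k)\<^sup>2)"
      unfolding add_diff_eq[symmetric] by (rule exp_ge_add_one_self)
  qed
  also have "\<dots> = exp ((3 * real k * real s - (real s ^ 3 - real s)) / (3 * (real k)\<^sup>2))"
    unfolding sum[symmetric] by (simp add: exp_sum)
  also have "\<dots> \<le> exp (1 / 3)"
    using poly k by (simp add: divide_le_eq)
  also have "\<dots> \<le> 3 / 2"
  proof (rule power_le_imp_le_base)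
    have "exp (1 / 3 :: real) ^ Suc 2 = exp 1" by (simp add: exp_of_nat_mult[symmetric])
    also have "\<dots> \<le> 3" by (rule exp_le)
    also have "\<dots> \<le> (3 / 2) ^ Suc 2" by (simp add: power_divide)
    finally show "exp (1 / 3 :: real) ^ Suc 2 \<le> (3 / 2) ^ Suc 2" .
  qed simp
  finally show ?thesis .
next
  case False
  then have "k = 3 \<or> k = 4" using k by auto
  moreover have "s = 0 \<or> s = 1 \<or> s = 2 \<or> s = 3 \<or> s = 4" using s False by auto
  ultimately show ?thesis using s
    by (auto simp: numeral_eq_Suc power2_eq_square)
qed

text \<open>
  If the mean is at most half the number of trials, the quotient of the two sides decreases up to
  the turning point and increases afterwards, so only indices before the turning point matter.
  There each factor is at least its limit for large \<open>m\<close>, and the limit product is controlled by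
  \<open>correction_prod_le\<close>.
\<close>

lemma rel_mass_ge_swap:
  assumes k: "3 \<le> k" and km: "k \<le> m"
  shows "2 / 3 * rel_mass m k j \<le> rel_mass k m j"
proof (induction j)
  case 0
  show ?case by simp
next
  case (Suc j)
  let ?x = "1 / real m" and ?y = "1 / real k"
  let ?u = "\<lambda>i. 1 + 1 / real k - real i * real (Suc i) / (real k)\<^sup>2"
  consider "k \<le> j" | "j < k" "1 \<le> real j * real (Suc j) * (?y + ?x)"
    | "j < k" "real j * real (Suc j) * (?y + ?x) < 1" by linarith
  then show ?case
  proof cases
    case 1
    then show ?thesis using k km by (simp add: rel_mass_eq_0 rel_mass_nonneg)
  next
    case 2
    then have "step_ratio m k j \<le> step_ratio k m j"
      using k km by (intro step_ratio_le(1)) auto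
    then have "(2 / 3 * rel_mass m k j) * step_ratio m k j \<le> rel_mass k m j * step_ratio k m j"
      using Suc 2 k km by (intro mult_mono) (auto intro!: step_ratio_nonneg rel_mass_nonneg)
    then show ?thesis by (simp add: rel_mass_Suc)
  next
    case 3
    have fac: "step_ratio m k i \<le> step_ratio k m i * ?u i" if "i \<le> j" for i
    proof -
      have "real i * real (Suc i) * ?x \<le> real j * real (Suc j) * ?x"
        using that by (intro mult_right_mono mult_mono) auto
      also have "\<dots> \<le> real j * real (Suc j) * (?y + ?x)" by (simp add: distrib_left)
      finally have le1: "real i * real (Suc i) * ?x \<le> 1" using 3 by simp
      have x: "0 < ?x" and y: "0 < ?y" using k km by auto
      have u: "?u i = (1 - real i * ?y) * (1 + real (Suc i) * ?y)"
        using k by (simp add: divide_simps power2_eq_square) (simp add: algebra_simps)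
      have iy: "0 \<le> 1 - real i * ?y" using that 3 by (simp add: divide_simps)
      have p: "1 + real (Suc i) * ?y > 0" "1 + real (Suc i) * ?x > 0"
        using x y by (auto intro!: add_pos_nonneg)
      have "(1 - real i * z) * (1 + real (Suc i) * z) = 1 + z * (1 - real i * real (Suc i) * z)"
        for z :: real by (simp add: algebra_simps)
      then have "(1 - real i * ?x) * (1 + real (Suc i) * ?x)
          = 1 + ?x * (1 - real i * real (Suc i) * ?x)" .
      moreover have "0 \<le> ?x * (1 - real i * real (Suc i) * ?x)"
        using le1 x by (intro mult_nonneg_nonneg) linarith+
      ultimately have ge1: "1 \<le> (1 - real i * ?x) * (1 + real (Suc i) * ?x)" by linarith
      have "step_ratio m k i = (1 - real i * ?y) * 1 / (1 + real (Suc i) * ?x)"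
        by (simp add: step_ratio_def)
      also have "\<dots> \<le> (1 - real i * ?y) * ((1 - real i * ?x) * (1 + real (Suc i) * ?x))
          / (1 + real (Suc i) * ?x)"
        using ge1 iy p by (intro divide_right_mono mult_left_mono) auto
      also have "\<dots> = (1 - real i * ?y) * (1 - real i * ?x)" using p by simp
      also have "\<dots> = step_ratio k m i * ?u i"
      proof -
        have "step_ratio k m i = (1 - real i * ?x) / (1 + real (Suc i) * ?y)"
          by (simp add: step_ratio_def)
        then show ?thesis unfolding u using p by simp
      qed
      finally show ?thesis .
    qed
    have "rel_mass m k (Suc j) \<le> (\<Prod>i<Suc j. step_ratio k m i * ?u i)"
      unfolding rel_mass_def using fac 3 by (intro prod_mono) (auto intro!: step_ratio_nonneg)
    also have "\<dots> = rel_mass k m (Suc j) * (\<Prod>i<Suc j. ?u i)"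
      unfolding rel_mass_def by (rule prod.distrib)
    also have "\<dots> \<le> rel_mass k m (Suc j) * (3 / 2)"
      using correction_prod_le[of k "Suc j"] k km 3
      by (intro mult_left_mono rel_mass_nonneg) auto
    finally show ?thesis by simp
  qed
qed

lemma rel_tail_ge_first:
  assumes "m \<ge> 1"
  shows "(\<Sum>j=1..N. rel_mass k m j) \<le> rel_tail k m"
proof -
  have "rel_tail k m = (\<Sum>j=1..m + N. rel_mass k m j)"
    using assms by (intro rel_tail_extend) auto
  also have "\<dots> \<ge> (\<Sum>j=1..N. rel_mass k m j)"
    using assms by (intro sum_mono2) (auto intro!: rel_mass_nonneg)
  finally show ?thesis .
qed

text \<open>
  For \<open>k = m = 1\<close>, which is the exceptional pair \<open>(2, 1/2)\<close>, both sides are equal to \<open>3/2\<close>.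
  For \<open>m \<le> k\<close> the tail above the mean is the larger one, so it suffices that it exceeds \<open>1/2\<close>.
  For \<open>3 \<le> k < m\<close> it is at least \<open>2/3\<close> of the other, so it suffices that the other exceeds 1,
  and its first two terms already do.  For \<open>k = 1\<close> and \<open>k = 2\<close> the tail below the mean is a sum
  of \<open>k\<close> terms and is compared with the first terms above the mean.
\<close>

lemma rel_tail_key:
  assumes k: "1 \<le> k" and m: "1 \<le> m" and not11: "(k, m) \<noteq> (1, 1)"
  shows "1 + rel_tail m k < 3 * rel_tail k m"
proof -
  consider "m \<le> k" "2 \<le> k" | "k = 1" "2 \<le> m" | "k = 2" "3 \<le> m" | "3 \<le> k" "k < m"
    using assms by fastforce
  then show ?thesis
  proof cases
    case 1
    have "2 / 3 \<le> step_ratio k m 0" using 1 by (simp add: step_ratio_def divide_simps)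
    then have "2 / 3 \<le> rel_tail k m"
      using rel_tail_ge_first[of m k 1] m by (simp add: rel_mass_Suc)
    then show ?thesis using rel_tail_ge_swap[OF m 1(1)] by linarith
  next
    case 2
    define x where "x = 1 / real m"
    have x: "0 < x" "x \<le> 1 / 2" using 2 by (auto simp: x_def divide_simps)
    define w where "w = 1 / 2 + (1 - x) / 6 + (1 - x) * (1 - 2 * x) / 24"
    have "(\<Sum>j=1..3. rel_mass k m j) = w"
      using 2 by (simp add: rel_mass_Suc step_ratio_def numeral_eq_Suc x_def w_def)
    then have up: "w \<le> rel_tail k m"
      using rel_tail_ge_first[of m k 3] m by simp
    have low: "rel_tail m k = 1 / (1 + x)"
      using 2 by (simp add: rel_tail_def rel_mass_Suc step_ratio_def x_def)
    have "0 < 1 + x * (2 - 5 * x) + 2 * x ^ 3"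
    proof -
      have "x * (- 1 / 2) \<le> x * (2 - 5 * x)" using x by (intro mult_left_mono) auto
      moreover have "0 \<le> x ^ 3" using x by simp
      ultimately show ?thesis using x by linarith
    qed
    then have "1 + 1 / (1 + x) < 3 * w"
      using x by (simp add: w_def field_simps power3_eq_cube)
    then show ?thesis using up low by linarith
  next
    case 3
    define x where "x = 1 / real m"
    have "(\<Sum>j=1..2. rel_mass k m j) = 2 / 3 + (1 - x) / 3"
      using 3 by (simp add: rel_mass_Suc step_ratio_def numeral_eq_Suc x_def)
    then have first: "2 / 3 + (1 - x) / 3 \<le> rel_tail k m"
      using rel_tail_ge_first[OF m, of k 2] by (simp only:)
    have "x \<le> 1 / 3" using 3 by (simp add: x_def divide_simps)
    then have "8 / 9 \<le> 2 / 3 + (1 - x) / 3" by (simp add: field_simps)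
    then have up: "8 / 9 \<le> rel_tail k m" using first by (rule order_trans)
    define a b where "a = step_ratio m 2 0" and "b = step_ratio m 2 1"
    have "a \<le> 1" "0 \<le> b" "b \<le> 1 / 2"
      using 3 by (simp_all add: a_def b_def step_ratio_def divide_simps)
    moreover from this have "a * b \<le> 1 * (1 / 2)" by (intro mult_mono) auto
    moreover have "rel_tail m k = a + a * b"
      using 3 by (simp add: rel_tail_def rel_mass_Suc numeral_eq_Suc a_def b_def)
    ultimately show ?thesis using up by linarith
  next
    case 4
    have "2 / 3 * rel_tail m k = (\<Sum>j=1..m + k. 2 / 3 * rel_mass m k j)"
      using k by (subst rel_tail_extend[of k "m + k" m]) (auto simp: sum_distrib_left)
    also have "\<dots> \<le> (\<Sum>j=1..m + k. rel_mass k m j)"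
      using 4 by (intro sum_mono rel_mass_ge_swap) auto
    also have "\<dots> = rel_tail k m" using m by (intro rel_tail_extend[symmetric]) auto
    finally have cmp: "2 / 3 * rel_tail m k \<le> rel_tail k m" .
    define a b where "a = step_ratio m k 0" and "b = step_ratio m k 1"
    have a: "3 / 4 \<le> a" using 4 by (simp add: a_def step_ratio_def divide_simps)
    have b: "2 / 5 \<le> b"
    proof -
      have "1 / real k \<le> 1 / 3" "2 / real m \<le> 2 / 3" using 4 by (simp_all add: divide_simps)
      then have "(2 / 3) / (5 / 3) \<le> (1 - 1 / real k) / (1 + 2 / real m)"
        by (intro frac_le) (auto intro!: add_pos_nonneg)
      then show ?thesis by (simp add: b_def step_ratio_def numeral_eq_Suc)
    qed
    have "(3 / 4) * (2 / 5) \<le> a * b" using a b by (intro mult_mono) auto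
    moreover have "a + a * b \<le> rel_tail m k"
      using rel_tail_ge_first[of k m 2] k
      by (simp add: rel_mass_Suc numeral_eq_Suc a_def b_def)
    ultimately have "1 < rel_tail m k" using a by linarith
    then show ?thesis using cmp by linarith
  qed
qed

section \<open>The tail above the mean\<close>

lemma bin_tail_above_mean:
  assumes n: "n \<ge> 1" and p: "ln (4 / 3) / real n \<le> p" "p < 1"
    and k: "real k \<le> real n * p" "real n * p < real k + 1"
    and ne: "(n, p) \<noteq> (2, 1 / 2)"
  shows "bin_tail n p (Suc k) > 1 / 4"
proof (cases "k = 0")
  case True
  have ln: "ln (4 / 3 :: real) > 0" by simp
  have "0 < ln (4 / 3) / real n" using ln n by simp
  then have p0: "p > 0" using p(1) by linarith
  have "1 - p < exp (- p)"
    using p0 exp_minus_greater[of p] by simp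
  then have "(1 - p) ^ n < exp (- p) ^ n"
    using p(2) n by (intro power_strict_mono) auto
  also have "\<dots> = exp (- (real n * p))" by (simp add: exp_of_nat_mult[symmetric])
  also have "\<dots> \<le> exp (- ln (4 / 3))"
    using p(1) n by (simp add: divide_le_eq mult.commute)
  also have "\<dots> = 3 / 4" by (simp add: exp_minus)
  finally have "(1 - p) ^ n < 3 / 4" .
  moreover have "1 = (1 - p) ^ n + bin_tail n p (Suc 0)"
    using bin_tail_0[of n p] unfolding bin_tail_def
    by (subst (asm) sum.atLeast_Suc_atMost) (auto simp: bin_mass_def)
  ultimately show ?thesis using True by simp
next
  case False
  have "real n * p < real n * 1" using n p by (intro mult_strict_left_mono) auto
  then have "k < n" using k by linarith
  define m where "m = n - k"
  have m: "m \<ge> 1" "n = k + m" using \<open>k < n\<close> by (auto simp: m_def)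
  show ?thesis
  proof (cases "(k, m) = (1, 1)")
    case True
    then have n2: "n = 2" and k1: "k = 1" using m by auto
    then have "p > 1 / 2" using k(1) ne by (cases "p = 1 / 2") auto
    then have "(1 / 2) * (1 / 2) < p * p" by (intro mult_strict_mono) auto
    then show ?thesis using n2 k1
      by (simp add: bin_tail_def bin_mass_def numeral_eq_Suc)
  next
    case ne11: False
    have "1 / 4 < bin_tail n (real k / real n) (Suc k)"
      unfolding m(2) using False m(1) rel_tail_key[OF _ m(1) ne11]
      by (subst bin_tail_gt_quarter_iff) auto
    also have "\<dots> \<le> bin_tail n p (Suc k)"
      using k n p by (intro bin_tail_mono) (auto simp: divide_le_eq mult.commute)
    finally show ?thesis .
  qed
qed

section \<open>From weights to random variables\<close>

lemma binomially_distributed_AE: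
  assumes "prob_space M" "binomially_distributed M X n p"
  shows "AE \<omega> in M. X \<omega> \<in> real ` {0..n}"
proof -
  interpret prob_space M by fact
  have X [measurable]: "X \<in> borel_measurable M"
    and mass: "\<And>i. i \<le> n \<Longrightarrow> prob {\<omega> \<in> space M. X \<omega> = real i} = bin_mass n p i"
    using assms(2) by (auto simp: binomially_distributed_def bin_mass_def)
  have "prob (\<Union>i\<in>{0..n}. {\<omega> \<in> space M. X \<omega> = real i})
      = (\<Sum>i=0..n. prob {\<omega> \<in> space M. X \<omega> = real i})"
    by (intro finite_measure_finite_Union) (auto simp: disjoint_family_on_def)
  also have "\<dots> = 1" using mass sum_bin_mass[of n p] by simp
  finally have "AE \<omega> in M. \<omega> \<in> (\<Union>i\<in>{0..n}. {\<omega> \<in> space M. X \<omega> = real i})"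
    by (subst (asm) prob_eq_1) auto
  then show ?thesis by eventually_elim auto
qed

lemma binomially_distributed_prob:
  assumes "prob_space M" "binomially_distributed M X n p"
  shows "measure M {\<omega> \<in> space M. X \<omega> > c} = (\<Sum>i | i \<le> n \<and> real i > c. bin_mass n p i)"
proof -
  interpret prob_space M by fact
  have X [measurable]: "X \<in> borel_measurable M"
    and mass: "\<And>i. i \<le> n \<Longrightarrow> prob {\<omega> \<in> space M. X \<omega> = real i} = bin_mass n p i"
    using assms(2) by (auto simp: binomially_distributed_def bin_mass_def)
  have "prob {\<omega> \<in> space M. X \<omega> > c}
      = prob (\<Union>i\<in>{i. i \<le> n \<and> real i > c}. {\<omega> \<in> space M. X \<omega> = real i})"
    using binomially_distributed_AE[OF assms]
    by (intro finite_measure_eq_AE) (auto elim!: eventually_mono)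
  also have "\<dots> = (\<Sum>i | i \<le> n \<and> real i > c. prob {\<omega> \<in> space M. X \<omega> = real i})"
    by (intro finite_measure_finite_Union) (auto simp: disjoint_family_on_def)
  also have "\<dots> = (\<Sum>i | i \<le> n \<and> real i > c. bin_mass n p i)"
    using mass by (intro sum.cong) auto
  finally show ?thesis .
qed

lemma bin_mass_mean: "(\<Sum>i=0..n. real i * bin_mass n p i) = real n * p"
proof (cases n)
  case 0
  then show ?thesis by simp
next
  case (Suc l)
  have "real (Suc i) * bin_mass n p (Suc i) = real n * p * bin_mass l p i" for i
  proof -
    have "real (Suc i) * real (Suc l choose Suc i) = real (Suc l) * real (l choose i)"
      by (metis Suc_times_binomial of_nat_mult)
    then show ?thesis unfolding Suc bin_mass_def by simp
  qed
  then have "(\<Sum>i=0..l. real (Suc i) * bin_mass n p (Suc i)) = real n * p"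
    by (simp add: sum_distrib_left[symmetric] sum_bin_mass)
  moreover have "(\<Sum>i=0..n. real i * bin_mass n p i)
      = (\<Sum>i=0..l. real (Suc i) * bin_mass n p (Suc i))"
    unfolding Suc sum.atLeast0_atMost_Suc_shift by simp
  ultimately show ?thesis by simp
qed

lemma binomially_distributed_expectation:
  assumes "prob_space M" "binomially_distributed M X n p"
  shows "integral\<^sup>L M X = real n * p"
proof -
  interpret prob_space M by fact
  have X [measurable]: "X \<in> borel_measurable M"
    and mass: "\<And>i. i \<le> n \<Longrightarrow> prob {\<omega> \<in> space M. X \<omega> = real i} = bin_mass n p i"
    using assms(2) by (auto simp: binomially_distributed_def bin_mass_def)
  let ?A = "\<lambda>i::nat. {\<omega> \<in> space M. X \<omega> = real i}"
  have "integral\<^sup>L M X = (\<integral>\<omega>. (\<Sum>i=0..n. real i * indicator (?A i) \<omega>) \<partial>M)"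
  proof (rule integral_cong_AE)
    show "AE \<omega> in M. X \<omega> = (\<Sum>i=0..n. real i * indicator (?A i) \<omega>)"
      using binomially_distributed_AE[OF assms] AE_space
    proof eventually_elim
      case (elim \<omega>)
      then obtain l where l: "l \<le> n" "X \<omega> = real l" by auto
      have "(\<Sum>i=0..n. real i * indicator (?A i) \<omega>) = (\<Sum>i=0..n. if i = l then real l else 0)"
        using l elim by (intro sum.cong) (auto simp: indicator_def)
      then show ?case using l by simp
    qed
    show "(\<lambda>\<omega>. \<Sum>i=0..n. real i * indicator (?A i) \<omega>) \<in> borel_measurable M"
      by measurable
  qed fact
  also have "\<dots> = (\<Sum>i=0..n. real i * prob (?A i))"
  proof -
    have "integrable M (indicator (?A i) :: 'a \<Rightarrow> real)" for i
      by (intro integrable_real_indicator) (auto simp: less_top[symmetric])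
    then show ?thesis by (subst Bochner_Integration.integral_sum) auto
  qed
  also have "\<dots> = real n * p" using mass bin_mass_mean[of n p] by simp
  finally show ?thesis .
qed

theorem mainTheorem4:
  fixes M :: "'a measure" and X :: "'a \<Rightarrow> real" and n :: nat and p :: real
  assumes "prob_space M"
    and "n \<ge> 1"
    and "ln (4 / 3) / real n \<le> p" and "p < 1"
    and "binomially_distributed M X n p"
  shows "((n, p) \<noteq> (2, 1 / 2) \<longrightarrow>
            measure M {\<omega> \<in> space M. X \<omega> > integral\<^sup>L M X} > 1 / 4)
       \<and> ((n, p) = (2, 1 / 2) \<longrightarrow>
            measure M {\<omega> \<in> space M. X \<omega> > integral\<^sup>L M X} = 1 / 4)"
proof -
  define k where "k = nat \<lfloor>real n * p\<rfloor>"
  have "0 \<le> ln (4 / 3 :: real) / real n" by simp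
  then have "0 \<le> p" using assms(3) by linarith
  then have "0 \<le> real n * p" by simp
  then have k: "real k \<le> real n * p" "real n * p < real k + 1"
    unfolding k_def by linarith+
  then have "{i. i \<le> n \<and> real i > real n * p} = {Suc k..n}"
    by auto
  then have tail: "measure M {\<omega> \<in> space M. X \<omega> > integral\<^sup>L M X} = bin_tail n p (Suc k)"
    by (simp add: binomially_distributed_expectation[OF assms(1,5)]
        binomially_distributed_prob[OF assms(1,5)] bin_tail_def)
  have "bin_tail n p (Suc k) = 1 / 4" if "(n, p) = (2, 1 / 2)"
  proof -
    have "k = 1" using that k by auto
    moreover have "n = 2" and p: "p = 1 / 2" using that by auto
    ultimately show ?thesis
      unfolding p by (simp add: bin_tail_def bin_mass_def numeral_eq_Suc)
  qed
  then show ?thesis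
    unfolding tail using bin_tail_above_mean[OF assms(2-4) k] by auto
qed

end
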